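(* Let $f$ be a non-negative, non-increasing function defined on $[t_0,+\infty)$ such that for all real $s,t$ with $s>t\ge t_0$, $$f(s)\le\frac{C}{(s-t)^\alpha}\,f(t)\,\log^{-\beta}\left(1+\frac1{f(t)}\right),$$ where $C$, $\alpha$ and $\beta$ are positive constants and $\beta>\alpha$. Then for any $\gamma\in\left(1,\frac\beta\alpha\right]$ we have $f(t_0+T_\gamma)=0$, where $$T_\gamma:=\begin{cases}\dfrac{(C\mathrm{e})^{\frac1\alpha}\left(\frac2{\log2}\right)^\gamma}{(\gamma-1)\log^{\frac\beta\alpha-\gamma}\left(1+\frac1{f(t_0)}\right)},&0\le f(t_0)\le1,\\[3ex]\dfrac{(C\mathrm{e})^{\frac1\alpha}2^\gamma}{(\gamma-1)\log^{\frac\beta\alpha}\left(1+\frac1{f(t_0)}\right)},&f(t_0)>1,\end{cases}$$ or equivalently $$T_\gamma=\frac{(C\mathrm{e})^{\frac1\alpha}\left(\frac2{\log2}\right)^\gamma}{\gamma-1}\max\left\{\frac1{\log^{\frac\beta\alpha-\gamma}\left(1+\frac1{f(t_0)}\right)},\ \frac{\log^\gamma2}{\log^{\frac\beta\alpha}\left(1+\frac1{f(t_0)}\right)}\right\}.$$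
   Context: $\log^a x$ means $(\log x)^a$. When $f(t)=0$, expressions are read with the conventions $\frac10=+\infty$, $\log(+\infty)=+\infty$, $(+\infty)^{-a}=0$ for $a>0$ and $(+\infty)^0=1$; in particular the right-hand side of the hypothesis is $0$ when $f(t)=0$. *)

theory Defs
  imports Complex_Main
begin

text \<open>
  \<open>log_inv_powr y a\<close> is \<open>log\<^sup>-\<^sup>a (1 + 1/y)\<close> for \<open>y \<ge> 0\<close> and \<open>a \<ge> 0\<close>. The case \<open>y = 0\<close>
  encodes the conventions \<open>1/0 = +\<infinity>\<close>, \<open>log (+\<infinity>) = +\<infinity>\<close>, \<open>(+\<infinity>)\<^sup>-\<^sup>a = 0\<close> for \<open>a > 0\<close> and
  \<open>(+\<infinity>)\<^sup>0 = 1\<close>. It has to be separated because in HOL \<open>1 / 0 = 0\<close> and \<open>0 powr 0 = 0\<close>,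
  so the plain formula would give \<open>0\<close> instead of \<open>1\<close> at \<open>y = 0\<close>, \<open>a = 0\<close>.
\<close>

definition log_inv_powr :: "real \<Rightarrow> real \<Rightarrow> real" where
  "log_inv_powr y a =
     (if y = 0 then (if a = 0 then 1 else 0) else 1 / ln (1 + 1 / y) powr a)"

text \<open>
  In \<open>vanishing_time\<close> and \<open>vanishing_time_max\<close> the argument \<open>y\<close> stands for \<open>f t0 \<ge> 0\<close>.
\<close>

definition vanishing_time :: "real \<Rightarrow> real \<Rightarrow> real \<Rightarrow> real \<Rightarrow> real \<Rightarrow> real" where
  "vanishing_time C \<alpha> \<beta> \<gamma> y =
     (if y \<le> 1
      then (C * exp 1) powr (1 / \<alpha>) * (2 / ln 2) powr \<gamma> / (\<gamma> - 1)
             * log_inv_powr y (\<beta> / \<alpha> - \<gamma>)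
      else (C * exp 1) powr (1 / \<alpha>) * 2 powr \<gamma> / (\<gamma> - 1)
             * log_inv_powr y (\<beta> / \<alpha>))"

definition vanishing_time_max :: "real \<Rightarrow> real \<Rightarrow> real \<Rightarrow> real \<Rightarrow> real \<Rightarrow> real" where
  "vanishing_time_max C \<alpha> \<beta> \<gamma> y =
     (C * exp 1) powr (1 / \<alpha>) * (2 / ln 2) powr \<gamma> / (\<gamma> - 1)
       * max (log_inv_powr y (\<beta> / \<alpha> - \<gamma>)) (ln 2 powr \<gamma> * log_inv_powr y (\<beta> / \<alpha>))"

end

theory Submission
  imports Defs
begin

text \<open>
  Put \<open>y = f t0\<close> and take steps of length \<open>(C e)\<^bsup>1/\<alpha>\<^esup> / log\<^bsup>\<beta>/\<alpha>\<^esup> (1 + e\<^sup>i / y)\<close>. The hypothesis shows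
  that each step divides the bound on \<open>f\<close> by \<open>e\<close>, so \<open>f\<close> vanishes at \<open>t0 + T\<close> when \<open>T\<close> bounds all the
  partial sums of the step lengths. Convexity of \<open>exp\<close> gives \<open>log (1 + e\<^sup>i / y) \<ge> (m / 2) (i + 2)\<close>
  with \<open>m = min (log 2) (log (1 + 1 / y))\<close>, and comparing \<open>\<Sum> (i + 2)\<^bsup>-\<gamma>\<^esup>\<close> with the integral of
  \<open>x\<^bsup>-\<gamma>\<^esup>\<close> over \<open>[1, \<infinity>)\<close> bounds these sums by \<open>T\<^sub>\<gamma>\<close>.
\<close>

section \<open>Comparison of a power sum with an integral\<close>

text \<open>The right-hand side is the integral of \<open>a * t powr (- (a + 1))\<close> over
  \<open>[x, x + 1]\<close>, the left-hand side the smallest value of this integrand there. The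
  proof avoids integration: with \<open>z = x / (x + 1)\<close>, the bounds
  \<open>ln z \<le> z - 1\<close> and \<open>1 + u \<le> exp u\<close> give
  \<open>1 + a / (x + 1) \<le> z powr (- a)\<close>.\<close>

lemma powr_neg_telescope:
  fixes a x :: real
  assumes "a > 0" "x > 0"
  shows "a * (x + 1) powr (- (a + 1)) \<le> x powr (- a) - (x + 1) powr (- a)"
proof -
  define z where "z = x / (x + 1)"
  have z: "z > 0" "z - 1 = - (1 / (x + 1))"
    using assms by (auto simp: z_def field_simps)
  have "1 + a / (x + 1) \<le> 1 - a * ln z"
    using mult_left_mono[OF ln_le_minus_one[OF z(1)], of a] assms unfolding z(2) by simp
  also have "\<dots> \<le> z powr (- a)"
    using exp_ge_add_one_self[of "- a * ln z"] z by (simp add: powr_def)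
  finally have "(1 + a / (x + 1)) * (x + 1) powr (- a) \<le> z powr (- a) * (x + 1) powr (- a)"
    by (rule mult_right_mono) simp
  also have "\<dots> = x powr (- a)"
    using assms z by (simp add: z_def flip: powr_mult)
  finally have "(x + 1) powr (- a) + a * ((x + 1) powr (- a) / (x + 1)) \<le> x powr (- a)"
    by (simp add: algebra_simps)
  moreover have "(x + 1) powr (- a) / (x + 1) = (x + 1) powr (- (a + 1))"
    using powr_diff[of "x + 1" "- a" 1] assms by simp
  ultimately show ?thesis by simp
qed

lemma sum_powr_neg_le:
  fixes \<gamma> :: real
  assumes "\<gamma> > 1"
  shows "(\<Sum>i<n. (real i + 2) powr (- \<gamma>)) \<le> 1 / (\<gamma> - 1)"
proof -
  \<comment> \<open>The subtracted term is what the telescoping leaves over; the induction needs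
    it.\<close>
  have "(\<gamma> - 1) * (\<Sum>i<n. (real i + 2) powr (- \<gamma>)) \<le> 1 - (real n + 1) powr (- (\<gamma> - 1))"
  proof (induction n)
    case (Suc n)
    then show ?case
      using powr_neg_telescope[of "\<gamma> - 1" "real n + 1"] assms
      by (simp add: algebra_simps)
  qed simp
  also have "\<dots> \<le> 1" by simp
  finally show ?thesis
    using assms by (simp add: field_simps)
qed

section \<open>Lower bounds for the logarithm and the sum of the step lengths\<close>

lemma ln_one_plus_divide_pos:
  fixes x y :: real
  assumes "x > 0" "y > 0"
  shows "ln (1 + x / y) > 0"
  using assms by (intro ln_gt_zero) simp

text \<open>The left-hand side is the tangent at \<open>x = 0\<close> of the right-hand side, which
  is convex in \<open>x\<close>.\<close>

lemma ln_one_plus_exp_ge: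
  fixes x y :: real
  assumes "y > 0"
  shows "ln (1 + 1 / y) + x / (y + 1) \<le> ln (1 + exp x / y)"
proof -
  \<comment> \<open>With this \<open>m\<close> the linear terms cancel when \<open>exp\<close> is
    bounded below by its tangent at \<open>- m\<close> with weight \<open>y\<close> and at
    \<open>x - m\<close> with weight 1.\<close>
  define m where "m = x / (y + 1)"
  have x: "x = m * (y + 1)" using assms by (simp add: m_def)
  have "y * (1 - m) + (1 + (x - m)) \<le> y * exp (- m) + exp (x - m)"
    using exp_ge_add_one_self[of "- m"] exp_ge_add_one_self[of "x - m"] assms
    by (intro add_mono mult_left_mono) auto
  moreover have "y * (1 - m) + (1 + (x - m)) = y + 1"
    unfolding x by (simp add: algebra_simps)
  ultimately have "exp m * (y + 1) \<le> exp m * (y * exp (- m) + exp (x - m))"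
    by simp
  also have "\<dots> = y + exp x"
    by (simp add: algebra_simps exp_minus exp_diff)
  finally have "exp m * (y + 1) / y \<le> (y + exp x) / y"
    using assms by (simp add: divide_right_mono)
  then have "(1 + 1 / y) * exp m \<le> 1 + exp x / y"
    using assms by (simp add: add_divide_distrib algebra_simps)
  then have "ln ((1 + 1 / y) * exp m) \<le> ln (1 + exp x / y)"
    using assms by (intro ln_mono) (auto intro!: mult_pos_pos add_pos_pos)
  moreover have "ln ((1 + 1 / y) * exp m) = ln (1 + 1 / y) + m"
    using add_pos_pos[of 1 "1 / y"] assms by (subst ln_mult) auto
  ultimately show ?thesis by (simp add: m_def)
qed

text \<open>Weakens the tangent bound to a multiple of \<open>x + 2\<close>: the intercept is at
  least the minimum, and the slope \<open>1 / (y + 1)\<close> at least half of it. For the slope,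
  \<open>ln 2 \<le> 1\<close> is used if \<open>y \<le> 1\<close>, and
  \<open>ln (1 + 1 / y) \<le> 1 / y\<close> otherwise.\<close>

lemma ln_one_plus_exp_ge_linear:
  fixes x y :: real
  assumes "y > 0" "x \<ge> 0"
  shows "min (ln 2) (ln (1 + 1 / y)) / 2 * (x + 2) \<le> ln (1 + exp x / y)"
proof -
  define m where "m = min (ln 2) (ln (1 + 1 / y))"
  have "m / 2 \<le> 1 / (y + 1)"
  proof (cases "y \<le> 1")
    case True
    have "m \<le> 1" using ln_le_minus_one[of 2] by (simp add: m_def)
    with True assms show ?thesis by (simp add: field_simps) (smt (verit) mult_left_le mult.commute)
  next
    case False
    have "m \<le> 1 / y" using ln_add_one_self_le_self[of "1 / y"] assms by (simp add: m_def)
    also have "\<dots> \<le> 2 / (y + 1)" using False by (simp add: field_simps)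
    finally show ?thesis by simp
  qed
  then have "m / 2 * x \<le> x / (y + 1)"
    using mult_right_mono[of "m / 2" "1 / (y + 1)" x] assms by simp
  moreover have "m \<le> ln (1 + 1 / y)" by (simp add: m_def)
  moreover have "m / 2 * (x + 2) = m / 2 * x + m" by (simp add: algebra_simps)
  ultimately show ?thesis
    using ln_one_plus_exp_ge[OF assms(1), of x] unfolding m_def[symmetric] by linarith
qed

text \<open>The exponent is split as \<open>b = (b - \<gamma>) + \<gamma>\<close>. The first part is
  bounded by its value at \<open>i = 0\<close>, possible since \<open>\<gamma> \<le> b\<close>; the
  second gets the linear bound, and \<open>\<gamma> > 1\<close> makes it summable.\<close>

lemma sum_ln_powr_neg_le:
  fixes y b \<gamma> :: real
  assumes y: "y > 0" and \<gamma>: "1 < \<gamma>" "\<gamma> \<le> b"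
  defines "L \<equiv> ln (1 + 1 / y)"
  shows "(\<Sum>i<n. ln (1 + exp (real i) / y) powr (- b))
           \<le> L powr (- (b - \<gamma>)) * (2 / min (ln 2) L) powr \<gamma> / (\<gamma> - 1)"
proof -
  define m where "m = min (ln 2) L"
  have L: "L > 0" using y by (simp add: L_def ln_one_plus_divide_pos)
  then have m: "m > 0" by (simp add: m_def)
  have "ln (1 + exp (real i) / y) powr (- b)
          \<le> L powr (- (b - \<gamma>)) * ((2 / m) powr \<gamma> * (real i + 2) powr (- \<gamma>))" for i
  proof -
    define l where "l = ln (1 + exp (real i) / y)"
    have "L \<le> l"
      unfolding L_def l_def using y by (intro ln_mono) (auto simp: divide_right_mono add_pos_pos)
    have "l powr (- b) = l powr (- (b - \<gamma>)) * l powr (- \<gamma>)"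
      by (simp flip: powr_add)
    also have "\<dots> \<le> L powr (- (b - \<gamma>)) * (m / 2 * (real i + 2)) powr (- \<gamma>)"
      using \<open>L \<le> l\<close> L m \<gamma> ln_one_plus_exp_ge_linear[OF y, of "real i"]
      by (intro mult_mono powr_mono2') (auto simp: m_def L_def l_def)
    also have "(m / 2 * (real i + 2)) powr (- \<gamma>) = (m / 2) powr (- \<gamma>) * (real i + 2) powr (- \<gamma>)"
      by (rule powr_mult)
    also have "(m / 2) powr (- \<gamma>) = (2 / m) powr \<gamma>"
      using m by (simp add: powr_minus powr_divide field_simps)
    finally show ?thesis by (simp add: l_def)
  qed
  then have "(\<Sum>i<n. ln (1 + exp (real i) / y) powr (- b))
      \<le> (\<Sum>i<n. L powr (- (b - \<gamma>)) * ((2 / m) powr \<gamma> * (real i + 2) powr (- \<gamma>)))"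
    by (rule sum_mono)
  also have "\<dots> = L powr (- (b - \<gamma>)) * (2 / m) powr \<gamma> * (\<Sum>i<n. (real i + 2) powr (- \<gamma>))"
    by (simp add: sum_distrib_left mult.assoc)
  also have "\<dots> \<le> L powr (- (b - \<gamma>)) * (2 / m) powr \<gamma> * (1 / (\<gamma> - 1))"
    using sum_powr_neg_le[OF \<gamma>(1)] by (intro mult_left_mono) auto
  finally show ?thesis by (simp add: m_def)
qed

section \<open>Forms of the vanishing time\<close>

lemma ln_2_le_iff:
  fixes y :: real
  assumes "y > 0"
  shows "ln 2 \<le> ln (1 + 1 / y) \<longleftrightarrow> y \<le> 1"
  using assms by (subst ln_le_cancel_iff) (auto simp: field_simps add_pos_pos)

text \<open>The minimum switches exactly at \<open>y = 1\<close>, so it merges both cases of the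
  definition into the form in which the step lengths are summed.\<close>

lemma vanishing_time_eq:
  fixes y :: real
  assumes y: "y > 0"
  defines "L \<equiv> ln (1 + 1 / y)"
  shows "vanishing_time C \<alpha> \<beta> \<gamma> y =
    (C * exp 1) powr (1 / \<alpha>) *
      (L powr (- (\<beta> / \<alpha> - \<gamma>)) * (2 / min (ln 2) L) powr \<gamma> / (\<gamma> - 1))"
proof (cases "y \<le> 1")
  case True
  then show ?thesis
    using y ln_2_le_iff[OF y]
    by (simp add: vanishing_time_def log_inv_powr_def L_def min_absorb1 powr_minus_divide[of _ "\<beta> / \<alpha> - \<gamma>"]
        del: minus_diff_eq)
next
  case False
  have L: "L > 0" using y by (simp add: L_def ln_one_plus_divide_pos)
  have "min (ln 2) L = L" using False ln_2_le_iff[OF y] by (simp add: L_def)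
  moreover have "L powr (- (\<beta> / \<alpha> - \<gamma>)) * (2 / L) powr \<gamma> = 2 powr \<gamma> / L powr (\<beta> / \<alpha>)"
    using L by (simp add: powr_divide powr_diff)
  ultimately show ?thesis
    using y False by (simp add: vanishing_time_def log_inv_powr_def L_def)
qed

text \<open>For \<open>y > 0\<close> the two entries of the maximum are
  \<open>L powr \<gamma>\<close> and \<open>ln 2 powr \<gamma>\<close> times a common nonnegative
  factor, so the larger one is decided by whether \<open>y \<le> 1\<close>.\<close>

lemma vanishing_time_max_eq:
  fixes y :: real
  assumes y: "y \<ge> 0" and \<gamma>: "\<gamma> > 0" and ba: "\<beta> / \<alpha> > 0"
  shows "vanishing_time_max C \<alpha> \<beta> \<gamma> y = vanishing_time C \<alpha> \<beta> \<gamma> y"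
proof (cases "y = 0")
  case True
  \<comment> \<open>At \<open>y = 0\<close> the second entry is 0 and the first is 0 or 1 by
    convention, so the maximum is the first.\<close>
  with ba show ?thesis
    by (auto simp: vanishing_time_max_def vanishing_time_def log_inv_powr_def max_def)
next
  case False
  with y have y: "y > 0" by simp
  define L where "L = ln (1 + 1 / y)"
  have L: "L > 0" using y by (simp add: L_def ln_one_plus_divide_pos)
  have first: "log_inv_powr y (\<beta> / \<alpha> - \<gamma>) = L powr \<gamma> * log_inv_powr y (\<beta> / \<alpha>)"
    using y L by (simp add: log_inv_powr_def L_def powr_diff)
  have nonneg: "log_inv_powr y (\<beta> / \<alpha>) \<ge> 0" by (simp add: log_inv_powr_def)
  show ?thesis
  proof (cases "y \<le> 1")
    case True
    then have "ln 2 powr \<gamma> \<le> L powr \<gamma>"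
      using ln_2_le_iff[OF y] \<gamma> by (intro powr_mono2) (auto simp: L_def)
    then show ?thesis
      using True nonneg
      by (simp add: vanishing_time_max_def vanishing_time_def first mult_right_mono max_absorb1)
  next
    case False
    then have "L powr \<gamma> \<le> ln 2 powr \<gamma>"
      using ln_2_le_iff[OF y] \<gamma> L by (intro powr_mono2) (auto simp: L_def)
    then show ?thesis
      using False nonneg
      by (simp add: vanishing_time_max_def vanishing_time_def first mult_right_mono max_absorb2
          powr_divide)
  qed
qed

section \<open>Decay of \<open>f\<close> along the steps\<close>

text \<open>Both factors grow with \<open>u\<close>. This allows an upper bound for
  \<open>f t\<close> to replace \<open>f t\<close> in the decay hypothesis.\<close>

lemma mult_log_inv_powr_mono:
  fixes u v b :: real
  assumes "0 \<le> u" "u \<le> v" "0 < v" "0 < b"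
  shows "u * log_inv_powr u b \<le> v * (1 / ln (1 + 1 / v) powr b)"
proof (cases "u = 0")
  case False
  with assms have u: "u > 0" by simp
  have "ln (1 + 1 / v) \<le> ln (1 + 1 / u)"
    using u assms by (intro ln_mono) (auto simp: frac_le add_pos_pos)
  then have "1 / ln (1 + 1 / u) powr b \<le> 1 / ln (1 + 1 / v) powr b"
    using assms ln_one_plus_divide_pos[of 1 u] ln_one_plus_divide_pos[of 1 v] u
    by (intro divide_left_mono powr_mono2 mult_pos_pos) auto
  then have "u * (1 / ln (1 + 1 / u) powr b) \<le> v * (1 / ln (1 + 1 / v) powr b)"
    using assms by (intro mult_mono) auto
  then show ?thesis
    using u by (simp add: log_inv_powr_def)
qed (use assms in simp)

text \<open>Each step length is computed from the bound \<open>v\<close> on \<open>f t\<close> and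
  not from \<open>f t\<close> itself; since \<open>exp (real n) / f t0 = 1 / v\<close>, the
  logarithmic factor at \<open>v\<close> cancels and exactly \<open>exp (- 1)\<close>
  remains.\<close>

lemma decay_along_steps:
  fixes f :: "real \<Rightarrow> real" and t0 C \<alpha> \<beta> :: real
  assumes nonneg: "\<And>t. t \<ge> t0 \<Longrightarrow> f t \<ge> 0"
    and pos: "C > 0" "\<alpha> > 0" "\<beta> > 0" "f t0 > 0"
    and decay: "\<And>s t. s > t \<Longrightarrow> t \<ge> t0 \<Longrightarrow>
      f s \<le> C / (s - t) powr \<alpha> * f t * log_inv_powr (f t) \<beta>"
  defines "step \<equiv> \<lambda>i. (C * exp 1) powr (1 / \<alpha>) * ln (1 + exp (real i) / f t0) powr (- (\<beta> / \<alpha>))"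
  shows "f (t0 + (\<Sum>i<n. step i)) \<le> f t0 * exp (- real n)"
proof (induction n)
  case (Suc n)
  define t where "t = t0 + (\<Sum>i<n. step i)"
  define v where "v = f t0 * exp (- real n)"
  define l where "l = ln (1 + 1 / v)"
  have v: "v > 0" using pos by (simp add: v_def)
  then have l: "l > 0" by (simp add: l_def ln_one_plus_divide_pos)
  have l_eq: "ln (1 + exp (real n) / f t0) = l"
    by (simp add: l_def v_def exp_minus field_simps)
  have step_pos: "step i > 0" for i
    using pos ln_one_plus_divide_pos[of "exp (real i)" "f t0"] by (simp add: step_def)
  have t: "t \<ge> t0"
    unfolding t_def using step_pos by (simp add: sum_nonneg less_imp_le)
  have "step n powr \<alpha> = C * exp 1 * l powr (- \<beta>)"
    using pos l by (simp add: step_def l_eq powr_mult powr_powr)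
  then have coeff: "C / step n powr \<alpha> = exp (- 1) * l powr \<beta>"
    using pos l step_pos[of n] by (simp add: powr_minus exp_minus divide_simps mult.commute)
  have "f (t + step n) \<le> C / step n powr \<alpha> * f t * log_inv_powr (f t) \<beta>"
    using decay[of t "t + step n"] step_pos[of n] t by simp
  also have "\<dots> = C / step n powr \<alpha> * (f t * log_inv_powr (f t) \<beta>)"
    by simp
  also have "\<dots> \<le> C / step n powr \<alpha> * (v * (1 / l powr \<beta>))"
    unfolding l_def using pos v nonneg[OF t] Suc.IH
    by (intro mult_left_mono mult_log_inv_powr_mono) (auto simp: v_def t_def)
  also have "\<dots> = v * exp (- 1)"
    unfolding coeff using l by simp
  also have "\<dots> = f t0 * exp (- real (Suc n))"
    by (simp add: v_def flip: exp_add)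
  finally show ?case by (simp add: t_def add.assoc)
qed simp

theorem theorem3p1:
  fixes f :: "real \<Rightarrow> real" and t0 C \<alpha> \<beta> \<gamma> :: real
  assumes nonneg: "\<And>t. t \<ge> t0 \<Longrightarrow> f t \<ge> 0"
    and noninc: "antimono_on {t0..} f"
    and pos: "C > 0" "\<alpha> > 0" "\<beta> > 0"
    and beta_gt: "\<beta> > \<alpha>"
    and decay: "\<And>s t. s > t \<Longrightarrow> t \<ge> t0 \<Longrightarrow>
      f s \<le> C / (s - t) powr \<alpha> * f t * log_inv_powr (f t) \<beta>"
    and gamma: "\<gamma> \<in> {1<..\<beta> / \<alpha>}"
  shows "f (t0 + vanishing_time C \<alpha> \<beta> \<gamma> (f t0)) = 0
    \<and> vanishing_time C \<alpha> \<beta> \<gamma> (f t0) = vanishing_time_max C \<alpha> \<beta> \<gamma> (f t0)"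
proof
  let ?T = "vanishing_time C \<alpha> \<beta> \<gamma> (f t0)"
  have \<gamma>: "1 < \<gamma>" "\<gamma> \<le> \<beta> / \<alpha>" using gamma by auto
  have anti: "f s \<le> f t" if "t0 \<le> t" "t \<le> s" for s t
    using monotone_onD[OF noninc, of t s] that by simp
  have T: "?T \<ge> 0"
    using \<gamma> by (simp add: vanishing_time_def log_inv_powr_def)
  show "f (t0 + ?T) = 0"
  proof (cases "f t0 = 0")
    case True
    \<comment> \<open>Here \<open>?T\<close> can be positive, namely for
      \<open>\<gamma> = \<beta> / \<alpha>\<close>; monotonicity keeps \<open>f\<close> at
      0.\<close>
    then show ?thesis
      using anti[of t0 "t0 + ?T"] nonneg[of "t0 + ?T"] T by simp
  next
    case False
    with nonneg[of t0] have y: "f t0 > 0" by simp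
    define step where
      "step i = (C * exp 1) powr (1 / \<alpha>) * ln (1 + exp (real i) / f t0) powr (- (\<beta> / \<alpha>))" for i
    have "f (t0 + ?T) \<le> f t0 * exp (- real n)" for n
    proof -
      have "(\<Sum>i<n. step i) \<le> ?T"
        unfolding step_def vanishing_time_eq[OF y] sum_distrib_left[symmetric]
        by (intro mult_left_mono sum_ln_powr_neg_le y \<gamma>) simp
      \<comment> \<open>Monotonicity carries the bound from each partial sum to the one point
        \<open>t0 + ?T\<close>, where \<open>n\<close> can then tend to infinity.\<close>
      then have "f (t0 + ?T) \<le> f (t0 + (\<Sum>i<n. step i))"
        by (intro anti) (auto simp: step_def intro!: sum_nonneg)
      also have "\<dots> \<le> f t0 * exp (- real n)"
        unfolding step_def by (rule decay_along_steps[OF nonneg pos y decay])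
      finally show ?thesis .
    qed
    moreover have "(\<lambda>n. f t0 * exp (- real n)) \<longlonglongrightarrow> f t0 * 0"
      by (intro tendsto_mult_left filterlim_compose[OF exp_at_bot]
          filterlim_compose[OF filterlim_uminus_at_bot_at_top] filterlim_real_sequentially)
    ultimately have "f (t0 + ?T) \<le> f t0 * 0"
      by (intro LIMSEQ_le_const) auto
    then show ?thesis using nonneg[of "t0 + ?T"] T by simp
  qed
  show "?T = vanishing_time_max C \<alpha> \<beta> \<gamma> (f t0)"
    using vanishing_time_max_eq[of "f t0" \<gamma> \<beta> \<alpha> C] nonneg[of t0] \<gamma> pos by simp
qed

end
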